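(* Let $(Y,d)$ be a finite ultrametric space. Then for every $\varepsilon>0$ there are a space $W\in\mathfrak{U}$ and a bijective $\varepsilon$-isometry $\Phi\colon W\to Y$.
   Context: An ultrametric on a set $X$ is a function $d\colon X\times X\to[0,\infty)$ such that $d(x,y)=d(y,x)$, $d(x,y)=0\Leftrightarrow x=y$, and $d(x,y)\leqslant\max\{d(x,z),d(z,y)\}$ for all $x,y,z\in X$. The spectrum is $\operatorname{Sp}(X)=\{d(x,y)\colon x,y\in X\}$. $\mathfrak{U}$ is the class of finite ultrametric spaces $X$ with $|\operatorname{Sp}(X)|=|X|$. For semimetric spaces $(X,d)$, $(Y,\rho)$ (symmetric nonnegative functions vanishing exactly on the diagonal; in particular, for ultrametric spaces) and $\varepsilon>0$, a surjective mapping $F\colon X\to Y$ is an $\varepsilon$-isometry if $|d(x,y)-\rho(F(x),F(y))|\leqslant\varepsilon$ for all $x,y\in X$. *)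

theory Defs
  imports Complex_Main
begin

(* Spaces are pairs of a carrier set and a distance function; values of the distance function
   outside the carrier are unconstrained. *)

definition semimetric_on :: "'a set \<Rightarrow> ('a \<Rightarrow> 'a \<Rightarrow> real) \<Rightarrow> bool" where
  "semimetric_on X d \<longleftrightarrow>
     (\<forall>x\<in>X. \<forall>y\<in>X. 0 \<le> d x y) \<and>
     (\<forall>x\<in>X. \<forall>y\<in>X. d x y = d y x) \<and>
     (\<forall>x\<in>X. \<forall>y\<in>X. d x y = 0 \<longleftrightarrow> x = y)"

definition ultrametric_on :: "'a set \<Rightarrow> ('a \<Rightarrow> 'a \<Rightarrow> real) \<Rightarrow> bool" where
  "ultrametric_on X d \<longleftrightarrow>
     semimetric_on X d \<and>
     (\<forall>x\<in>X. \<forall>y\<in>X. \<forall>z\<in>X. d x y \<le> max (d x z) (d z y))"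

definition spectrum :: "'a set \<Rightarrow> ('a \<Rightarrow> 'a \<Rightarrow> real) \<Rightarrow> real set" where
  "spectrum X d = {d x y | x y. x \<in> X \<and> y \<in> X}"

definition in_class_U :: "'a set \<Rightarrow> ('a \<Rightarrow> 'a \<Rightarrow> real) \<Rightarrow> bool" where
  "in_class_U X d \<longleftrightarrow> finite X \<and> ultrametric_on X d \<and> card (spectrum X d) = card X"

(* The second conjunct says that F is a surjection from X onto Y. *)
definition eps_isometry ::
  "real \<Rightarrow> 'a set \<Rightarrow> ('a \<Rightarrow> 'a \<Rightarrow> real) \<Rightarrow> 'b set \<Rightarrow> ('b \<Rightarrow> 'b \<Rightarrow> real) \<Rightarrow> ('a \<Rightarrow> 'b) \<Rightarrow> bool" where
  "eps_isometry \<epsilon> X d Y \<rho> F \<longleftrightarrow>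
     semimetric_on X d \<and> F ` X = Y \<and> semimetric_on Y \<rho> \<and> \<epsilon> > 0 \<and>
     (\<forall>x\<in>X. \<forall>y\<in>X. \<bar>d x y - \<rho> (F x) (F y)\<bar> \<le> \<epsilon>)"

end

(* Induction on the number of points, with the invariant that the perturbed distance exceeds the
   original one by at most epsilon, and strictly so, off the diagonal.  Two points x, y at the
   smallest positive distance m have equal distances to all other points.  Delete x, perturb the
   rest by induction and put x back next to y at a distance t slightly larger than m: by the
   strictness of the invariant all perturbed positive distances are larger than m, so t can be
   chosen below all of them.  This preserves the ultrametric inequality and adds exactly one
   value, t, to the spectrum. *)
theory Submission
  imports Defs
begin

lemma ultrametric_on_subset:
  "ultrametric_on Y d \<Longrightarrow> X \<subseteq> Y \<Longrightarrow> ultrametric_on X d"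
  unfolding ultrametric_on_def semimetric_on_def by (meson subsetD)

lemma finite_spectrum: "finite X \<Longrightarrow> finite (spectrum X d)"
  unfolding spectrum_def by (rule finite_image_set2) auto

lemma real_between_finite:
  fixes m :: real
  assumes "finite S" and "\<And>s. s \<in> S \<Longrightarrow> m < s"
  obtains t where "m < t" and "\<And>s. s \<in> S \<Longrightarrow> t < s"
proof -
  \<comment> \<open>The extra element \<open>m + 1\<close> keeps \<open>Min\<close> defined when
    \<open>S\<close> is empty.\<close>
  have "m < Min (insert (m + 1) S)"
    using assms by (subst Min_gr_iff) auto
  then obtain t where "m < t" "t < Min (insert (m + 1) S)"
    using dense by blast
  with assms(1) show thesis
    by (intro that[of t]) auto
qed

lemma closest_pair:
  fixes d :: "'a \<Rightarrow> 'a \<Rightarrow> real"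
  assumes "finite Y" and "a \<in> Y" "b \<in> Y" "a \<noteq> b"
  obtains x y where "x \<in> Y" "y \<in> Y" "x \<noteq> y"
    and "\<And>u v. u \<in> Y \<Longrightarrow> v \<in> Y \<Longrightarrow> u \<noteq> v \<Longrightarrow> d x y \<le> d u v"
proof -
  define P where "P = {(u, v) \<in> Y \<times> Y. u \<noteq> v}"
  have "finite P"
    unfolding P_def by (rule finite_subset[of _ "Y \<times> Y"]) (use assms in auto)
  moreover have "P \<noteq> {}"
    using assms unfolding P_def by blast
  ultimately obtain p where p: "is_arg_min (\<lambda>(u, v). d u v) (\<lambda>p. p \<in> P) p"
    using ex_is_arg_min_if_finite by blast
  show thesis
    by (rule that[of "fst p" "snd p"])
      (use p in \<open>force simp: is_arg_min_linorder P_def\<close>)+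
qed

text \<open>The map \<open>p\<close> sends \<open>x\<close> to \<open>y\<close> and fixes every
  other point. The new distance is \<open>\<rho>\<close> pulled back along \<open>p\<close>, except
  that distinct points with the same image under \<open>p\<close> are put at distance
  \<open>t\<close>.\<close>

definition duplicate_point ::
  "'a \<Rightarrow> 'a \<Rightarrow> real \<Rightarrow> ('a \<Rightarrow> 'a \<Rightarrow> real) \<Rightarrow> 'a \<Rightarrow> 'a \<Rightarrow> real" where
  "duplicate_point x y t \<rho> a b =
     (let p = id(x := y) in if p a \<noteq> p b then \<rho> (p a) (p b) else if a = b then 0 else t)"

text \<open>For the strong triangle inequality, if \<open>p a\<close> and \<open>p b\<close> differ,
  it is inherited from \<open>\<rho>\<close>, trivially so when \<open>p c\<close> equals one of
  them. If they agree and \<open>a\<close> differs from \<open>b\<close>, the left side is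
  \<open>t\<close>, and \<open>c\<close> differs from \<open>a\<close> or \<open>b\<close>, so the
  right side is at least \<open>t\<close> by \<open>less\<close>.\<close>

lemma ultrametric_on_duplicate_point:
  assumes \<rho>: "ultrametric_on X \<rho>" and y: "y \<in> X" and t: "0 < t"
    and less: "\<And>u v. u \<in> X \<Longrightarrow> v \<in> X \<Longrightarrow> u \<noteq> v \<Longrightarrow> t < \<rho> u v"
  shows "ultrametric_on (insert x X) (duplicate_point x y t \<rho>)"
proof -
  define p where "p = id(x := y)"
  have p: "p a \<in> X" if "a \<in> insert x X" for a
    using that y by (auto simp: p_def)
  have eq: "duplicate_point x y t \<rho> a b =
      (if p a \<noteq> p b then \<rho> (p a) (p b) else if a = b then 0 else t)" for a b
    by (simp add: duplicate_point_def p_def Let_def)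
  have sym: "\<rho> u v = \<rho> v u" and tri: "\<rho> u v \<le> max (\<rho> u w) (\<rho> w v)"
    if "u \<in> X" "v \<in> X" "w \<in> X" for u v w
    using \<rho> that unfolding ultrametric_on_def semimetric_on_def by blast+
  have pos: "0 < \<rho> u v" if "u \<in> X" "v \<in> X" "u \<noteq> v" for u v
    using less[OF that] t by simp
  have "semimetric_on (insert x X) (duplicate_point x y t \<rho>)"
    unfolding semimetric_on_def eq
  proof (intro conjI ballI)
    fix a b assume "a \<in> insert x X" "b \<in> insert x X"
    then have ab: "p a \<in> X" "p b \<in> X" by (simp_all only: p)
    show "0 \<le> (if p a \<noteq> p b then \<rho> (p a) (p b) else if a = b then 0 else t)"
      using pos[OF ab] t by auto
    show "(if p a \<noteq> p b then \<rho> (p a) (p b) else if a = b then 0 else t) =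
        (if p b \<noteq> p a then \<rho> (p b) (p a) else if b = a then 0 else t)"
      using sym[OF ab ab(1)] by simp
    show "(if p a \<noteq> p b then \<rho> (p a) (p b) else if a = b then 0 else t) = 0 \<longleftrightarrow> a = b"
      using pos[OF ab] t by auto
  qed
  moreover have "duplicate_point x y t \<rho> a b \<le>
      max (duplicate_point x y t \<rho> a c) (duplicate_point x y t \<rho> c b)"
    if "a \<in> insert x X" "b \<in> insert x X" "c \<in> insert x X" for a b c
  proof -
    have abc: "p a \<in> X" "p b \<in> X" "p c \<in> X"
      using that by (simp_all only: p)
    show ?thesis
      unfolding eq
      using tri[OF abc] less[OF abc(1,3)] less[OF abc(3,2)] t by auto
  qed
  ultimately show ?thesis
    unfolding ultrametric_on_def by blast
qed

text \<open>The new point repeats the distances of \<open>y\<close>, its distance to itself is the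
  value 0 already attained at \<open>y\<close>, and \<open>t\<close> is attained at the pair
  \<open>x\<close>, \<open>y\<close>.\<close>

lemma spectrum_duplicate_point:
  assumes "ultrametric_on X \<rho>" and "y \<in> X" and "x \<notin> X"
  shows "spectrum (insert x X) (duplicate_point x y t \<rho>) = insert t (spectrum X \<rho>)"
proof (intro equalityI subsetI)
  have 0: "\<rho> u u = 0" if "u \<in> X" for u
    using assms(1) that unfolding ultrametric_on_def semimetric_on_def by blast
  have zero: "0 \<in> spectrum X \<rho>"
    unfolding spectrum_def using 0[OF assms(2)] assms(2) by force
  fix s
  {
    assume "s \<in> spectrum (insert x X) (duplicate_point x y t \<rho>)"
    then obtain a b where ab: "a \<in> insert x X" "b \<in> insert x X"
      and s: "s = duplicate_point x y t \<rho> a b"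
      unfolding spectrum_def by blast
    have mem: "\<rho> u v \<in> spectrum X \<rho>" if "u \<in> X" "v \<in> X" for u v
      using that unfolding spectrum_def by blast
    show "s \<in> insert t (spectrum X \<rho>)"
      using ab assms(2) zero by (auto simp: s duplicate_point_def Let_def intro: mem)
  next
    assume "s \<in> insert t (spectrum X \<rho>)"
    moreover have "t = duplicate_point x y t \<rho> x y"
      using assms by (auto simp: duplicate_point_def)
    moreover have "\<rho> u v = duplicate_point x y t \<rho> u v" if "u \<in> X" "v \<in> X" for u v
      using that assms(3) 0 by (auto simp: duplicate_point_def)
    ultimately show "s \<in> spectrum (insert x X) (duplicate_point x y t \<rho>)"
      using assms(2) unfolding spectrum_def by blast
  }
qed

lemma ultrametric_perturbation:
  fixes d :: "'a \<Rightarrow> 'a \<Rightarrow> real"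
  assumes "finite Y" and "ultrametric_on Y d" and \<epsilon>: "0 < \<epsilon>"
  shows "\<exists>\<rho>. in_class_U Y \<rho> \<and>
           (\<forall>u\<in>Y. \<forall>v\<in>Y. u \<noteq> v \<longrightarrow> d u v < \<rho> u v \<and> \<rho> u v \<le> d u v + \<epsilon>)"
  using assms(1,2)
\<comment> \<open>This rule gives the hypothesis for \<open>Y - {x}\<close> with any
  \<open>x\<close> in \<open>Y\<close>, so the deleted point can be chosen after inspecting the
  distances.\<close>
proof (induction Y rule: finite_remove_induct)
  case empty
  then show ?case by (auto simp: in_class_U_def spectrum_def)
next
  case (remove Y)
  show ?case
  proof (cases "\<exists>a\<in>Y. \<exists>b\<in>Y. a \<noteq> b")
    \<comment> \<open>On a single point \<open>d\<close> itself works: its spectrum is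
      \<open>{0}\<close> and the bounds off the diagonal are vacuous.\<close>
    case False
    with \<open>Y \<noteq> {}\<close> obtain y where "Y = {y}" by blast
    with remove.prems show ?thesis
      by (intro exI[of _ d]) (auto simp: in_class_U_def spectrum_def)
  next
    case True
    then obtain x y where xy: "x \<in> Y" "y \<in> Y" "x \<noteq> y"
      and least: "\<And>u v. u \<in> Y \<Longrightarrow> v \<in> Y \<Longrightarrow> u \<noteq> v \<Longrightarrow> d x y \<le> d u v"
      using closest_pair[OF \<open>finite Y\<close>] by metis
    define X where "X = Y - {x}"
    have Y: "Y = insert x X" and X: "x \<notin> X" "y \<in> X" "finite X"
      using xy \<open>finite Y\<close> by (auto simp: X_def)
    have "ultrametric_on X d"
      using remove.prems ultrametric_on_subset unfolding X_def by blast
    then obtain \<rho> where \<rho>: "in_class_U X \<rho>"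
      and close: "\<And>u v. u \<in> X \<Longrightarrow> v \<in> X \<Longrightarrow> u \<noteq> v \<Longrightarrow> d u v < \<rho> u v \<and> \<rho> u v \<le> d u v + \<epsilon>"
      using remove.IH[OF \<open>x \<in> Y\<close>] unfolding X_def by blast
    have um: "ultrametric_on X \<rho>" and card: "card (spectrum X \<rho>) = card X"
      using \<rho> unfolding in_class_U_def by auto
    have sym: "d u v = d v u" and nonneg: "0 \<le> d u v" and tri: "d u v \<le> max (d u w) (d w v)"
      if "u \<in> Y" "v \<in> Y" "w \<in> Y" for u v w
      using remove.prems that unfolding ultrametric_on_def semimetric_on_def by blast+
    \<comment> \<open>All upper barriers for \<open>t\<close>: staying below the nonzero values of
      \<open>\<rho>\<close> gives the ultrametric inequality and makes \<open>t\<close> a new value;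
      staying below \<open>d x y + \<epsilon>\<close> gives the invariant at the pair
      \<open>x\<close>, \<open>y\<close>.\<close>
    define S where "S = insert (d x y + \<epsilon>) (spectrum X \<rho> - {0})"
    have gt: "d x y < \<rho> u v" if "u \<in> X" "v \<in> X" "u \<noteq> v" for u v
      using least[of u v] close[OF that] that Y by fastforce
    have "d x y < s" if "s \<in> S" for s
    proof (cases "s = d x y + \<epsilon>")
      case False
      with that obtain u v where "u \<in> X" "v \<in> X" "s = \<rho> u v" "s \<noteq> 0"
        unfolding S_def spectrum_def by blast
      with gt um show ?thesis
        unfolding ultrametric_on_def semimetric_on_def by metis
    qed (use \<epsilon> in simp)
    moreover have "finite S"
      using finite_spectrum[OF \<open>finite X\<close>] by (simp add: S_def)
    ultimately obtain t where t: "d x y < t" "\<And>s. s \<in> S \<Longrightarrow> t < s"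
      using real_between_finite by blast
    have t0: "0 < t"
      using nonneg[of x y y] xy t(1) by simp
    have less: "t < \<rho> u v" if "u \<in> X" "v \<in> X" "u \<noteq> v" for u v
    proof (rule t(2))
      have "\<rho> u v \<noteq> 0"
        using um that unfolding ultrametric_on_def semimetric_on_def by blast
      then show "\<rho> u v \<in> S"
        using that unfolding S_def spectrum_def by blast
    qed
    \<comment> \<open>Since \<open>t\<close> is nonzero, membership would put \<open>t\<close> into
      \<open>S\<close> and yield \<open>t < t\<close>.\<close>
    have "t \<notin> spectrum X \<rho>"
      using t(2)[of t] t0 unfolding S_def by auto
    then have "card (spectrum Y (duplicate_point x y t \<rho>)) = card Y"
      using card X finite_spectrum[OF \<open>finite X\<close>]
      by (simp add: Y spectrum_duplicate_point[OF um])
    then have "in_class_U Y (duplicate_point x y t \<rho>)"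
      using ultrametric_on_duplicate_point[OF um \<open>y \<in> X\<close> t0 less] \<open>finite Y\<close>
      unfolding in_class_U_def Y by blast
    moreover have "d u v < duplicate_point x y t \<rho> u v \<and>
        duplicate_point x y t \<rho> u v \<le> d u v + \<epsilon>"
      if uv: "u \<in> Y" "v \<in> Y" "u \<noteq> v" for u v
    proof -
      \<comment> \<open>In an ultrametric triangle the two longest sides are equal, and
        \<open>d x y\<close> is a shortest side here. Hence the bounds known for
        \<open>\<rho>\<close> at \<open>y\<close> carry over to the copied distances at
        \<open>x\<close>.\<close>
      have same: "d x z = d y z" "d z x = d z y" if "z \<in> Y" "z \<noteq> x" "z \<noteq> y" for z
      proof -
        have "d x z \<le> max (d x y) (d y z)" "d y z \<le> max (d y x) (d x z)"
          using tri xy that by blast+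
        moreover have "d x y \<le> d y z" "d x y \<le> d x z" "d y x = d x y"
          using least that xy sym by blast+
        ultimately show "d x z = d y z" by simp
        then show "d z x = d z y"
          using sym that xy by metis
      qed
      have "t < d x y + \<epsilon>" "d y x = d x y"
        using t(2)[of "d x y + \<epsilon>"] sym xy by (auto simp: S_def)
      then show ?thesis
        using uv t(1) close[of u v] close[of y v] close[of u y] same[of u] same[of v] xy X
        by (auto simp: duplicate_point_def Let_def Y)
    qed
    ultimately show ?thesis by blast
  qed
qed

theorem theorem4p5:
  fixes Y :: "'a set" and d :: "'a \<Rightarrow> 'a \<Rightarrow> real"
  assumes "finite Y" and "ultrametric_on Y d"
  shows "\<forall>\<epsilon>>0. \<exists>(W :: 'a set) (\<rho> :: 'a \<Rightarrow> 'a \<Rightarrow> real) (\<Phi> :: 'a \<Rightarrow> 'a).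
           in_class_U W \<rho> \<and> bij_betw \<Phi> W Y \<and> eps_isometry \<epsilon> W \<rho> Y d \<Phi>"
proof (intro allI impI)
  fix \<epsilon> :: real
  assume \<epsilon>: "0 < \<epsilon>"
  obtain \<rho> where \<rho>: "in_class_U Y \<rho>"
    and close: "\<And>u v. u \<in> Y \<Longrightarrow> v \<in> Y \<Longrightarrow> u \<noteq> v \<Longrightarrow> d u v < \<rho> u v \<and> \<rho> u v \<le> d u v + \<epsilon>"
    using ultrametric_perturbation[OF assms \<epsilon>] by blast
  have semi: "semimetric_on Y \<rho>" "semimetric_on Y d"
    using \<rho> assms(2) unfolding in_class_U_def ultrametric_on_def by auto
  have "\<bar>\<rho> u v - d u v\<bar> \<le> \<epsilon>" if "u \<in> Y" "v \<in> Y" for u v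
  \<comment> \<open>The perturbation bounds cover only distinct points; on the diagonal both
    distances vanish.\<close>
  proof (cases "u = v")
    case True
    then have "\<rho> u v = 0" "d u v = 0"
      using semi that unfolding semimetric_on_def by blast+
    with \<epsilon> show ?thesis by simp
  next
    case False
    with close[OF that] show ?thesis by simp
  qed
  \<comment> \<open>Only the distance was changed, so the witnesses are \<open>W = Y\<close> and the
    identity map.\<close>
  then have "eps_isometry \<epsilon> Y \<rho> Y d id"
    using semi \<epsilon> unfolding eps_isometry_def by simp
  with \<rho> show "\<exists>(W :: 'a set) (\<rho> :: 'a \<Rightarrow> 'a \<Rightarrow> real) (\<Phi> :: 'a \<Rightarrow> 'a).
      in_class_U W \<rho> \<and> bij_betw \<Phi> W Y \<and> eps_isometry \<epsilon> W \<rho> Y d \<Phi>"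
    using bij_betw_id by blast
qed

end
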